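(* For the fan graph $F_{1,n}$ with $n\geq 3$, $$fix_f(F_{1,n})=\begin{cases}2, & \text{if } n=3,\\ 1, & \text{if } n\geq 4.\end{cases}$$
   Context: The fan graph $F_{1,n}$ of order $n+1$ is the join $K_1+P_n$ of a single vertex with the path $P_n$ on $n$ vertices (the single vertex is joined to every vertex of $P_n$). Let $\Gamma=\Gamma(G)$ be the automorphism group of a finite simple undirected graph $G$. For $u\in V(G)$, $O(u)$ is the $\Gamma$-orbit of $u$; for $x\in V(G)$, $\Gamma_x$ is the stabilizer of $x$ and $O_x(u)=\{\pi(u):\pi\in\Gamma_x\}$. Let $V_a(G)=\{(u,v): u\neq v,\ O(u)=O(v)\}$. For vertices $u,v$ let $F(u,v)=\{x\in V(G):O_x(u)\neq O_x(v)\}$. A function $g:V(G)\to[0,1]$ is a fixing function of $G$ if $\sum_{x\in F(u,v)}g(x)\ge 1$ for every $(u,v)\in V_a(G)$. Put $|g|=\sum_{x\in V(G)}g(x)$. The fractional fixing number $fix_f(G)$ is the minimum of $|g|$ over all fixing functions $g$ of $G$. *)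

theory Defs
  imports Complex_Main "HOL-Combinatorics.Permutations"
begin

record 'a graph =
  verts :: "'a set"
  edges :: "'a set set"

definition simple_graph :: "'a graph \<Rightarrow> bool" where
  "simple_graph G \<longleftrightarrow>
     finite (verts G) \<and> (\<forall>e\<in>edges G. e \<subseteq> verts G \<and> card e = 2)"

definition complete_graph :: "'a set \<Rightarrow> 'a graph" where
  "complete_graph V = \<lparr>verts = V, edges = {e. e \<subseteq> V \<and> card e = 2}\<rparr>"

definition path_graph :: "nat \<Rightarrow> nat graph" where
  "path_graph n = \<lparr>verts = {1..n}, edges = {{i, i + 1} |i. 1 \<le> i \<and> i < n}\<rparr>"

definition graph_join :: "'a graph \<Rightarrow> 'b graph \<Rightarrow> ('a + 'b) graph" where
  "graph_join G H =
     \<lparr>verts = verts G <+> verts H,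
      edges = (\<lambda>e. Inl ` e) ` edges G \<union> (\<lambda>e. Inr ` e) ` edges H
                \<union> {{Inl u, Inr v} |u v. u \<in> verts G \<and> v \<in> verts H}\<rparr>"

definition fan_graph :: "nat \<Rightarrow> (unit + nat) graph" where
  "fan_graph n = graph_join (complete_graph {()}) (path_graph n)"

(* Automorphisms are total functions that are the identity outside the vertex set,
   so that each automorphism of G is represented exactly once. *)
definition automorphisms :: "'a graph \<Rightarrow> ('a \<Rightarrow> 'a) set" where
  "automorphisms G =
     {p. p permutes verts G \<and>
         (\<forall>u\<in>verts G. \<forall>v\<in>verts G. {p u, p v} \<in> edges G \<longleftrightarrow> {u, v} \<in> edges G)}"

definition stab :: "'a graph \<Rightarrow> 'a \<Rightarrow> ('a \<Rightarrow> 'a) set" where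
  "stab G x = {p \<in> automorphisms G. p x = x}"

definition orb :: "'a graph \<Rightarrow> 'a \<Rightarrow> 'a set" where
  "orb G u = {p u |p. p \<in> automorphisms G}"

definition stab_orb :: "'a graph \<Rightarrow> 'a \<Rightarrow> 'a \<Rightarrow> 'a set" where
  "stab_orb G x u = {p u |p. p \<in> stab G x}"

(* The set V_a(G). *)
definition similar_pairs :: "'a graph \<Rightarrow> ('a \<times> 'a) set" where
  "similar_pairs G =
     {(u, v). u \<in> verts G \<and> v \<in> verts G \<and> u \<noteq> v \<and> orb G u = orb G v}"

(* The set F(u,v). *)
definition fixing_set :: "'a graph \<Rightarrow> 'a \<Rightarrow> 'a \<Rightarrow> 'a set" where
  "fixing_set G u v = {x \<in> verts G. stab_orb G x u \<noteq> stab_orb G x v}"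

(* Only the values of g on the vertices matter. *)
definition fixing_function :: "'a graph \<Rightarrow> ('a \<Rightarrow> real) \<Rightarrow> bool" where
  "fixing_function G g \<longleftrightarrow>
     (\<forall>x\<in>verts G. 0 \<le> g x \<and> g x \<le> 1) \<and>
     (\<forall>(u, v)\<in>similar_pairs G. 1 \<le> (\<Sum>x\<in>fixing_set G u v. g x))"

(* LEAST rather than Inf: the value is a minimum, attained by some fixing function. *)
definition frac_fixing_number :: "'a graph \<Rightarrow> real" where
  "frac_fixing_number G =
     (LEAST r. \<exists>g. fixing_function G g \<and> r = (\<Sum>x\<in>verts G. g x))"

lemma simple_graph_fan_graph: "simple_graph (fan_graph n)"
proof -
  have "card (Inl ` e :: (unit + nat) set) = card e" "card (Inr ` f :: (unit + nat) set) = card f"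
    for e f by (auto intro: card_image)
  then show ?thesis
    by (auto simp: simple_graph_def fan_graph_def graph_join_def complete_graph_def path_graph_def)
qed

lemma card_verts_fan_graph: "card (verts (fan_graph n)) = n + 1"
  by (simp add: fan_graph_def graph_join_def complete_graph_def path_graph_def card_Plus)

end

theory Submission
  imports Defs
begin

text \<open>
  Two observations, valid in every graph, carry the result. First, a vertex whose stabilizer is
  trivial lies in \<open>F(u,v)\<close> for all \<open>u \<noteq> v\<close>, while \<open>F(u,v)\<close> always contains both \<open>u\<close> and \<open>v\<close>, because \<open>{u}\<close>
  is an orbit of the stabilizer of \<open>u\<close>. These give the two optimal fixing functions: unit weight
  on one vertex with trivial stabilizer, or weight \<open>1/2\<close> on every vertex. Second, if an
  automorphism \<open>r\<close> takes \<open>u\<close> to \<open>v \<noteq> u\<close>, then \<open>(u,v)\<close> is a constrained pair and \<open>F(u,v)\<close> only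
  contains vertices moved by \<open>r\<close>; hence every fixing function has weight at least 1 on the vertices
  moved by \<open>r\<close> (lemma \<open>moved_weight_ge_1\<close>).

  For every \<open>n \<ge> 2\<close>, reversing the path moves a vertex, so the fractional fixing number is at
  least 1. For \<open>n \<ge> 4\<close> the hub is the only vertex adjacent to all the others, so every
  automorphism fixes it and acts on the path; if it also fixes an end of the path, it is the
  identity. An end of the path then has trivial stabilizer, and the value is 1.
  For \<open>n = 3\<close> the fan is a complete graph on four vertices without one edge: the middle path
  vertex is adjacent to all the others too and can be exchanged with the hub. This exchange
  and the reversal move disjoint pairs of vertices, so the weight is at least 2, and the constant
  function \<open>1/2\<close> attains this bound on the four vertices.
\<close>

section \<open>Fixing functions and automorphisms\<close>

lemma automorphisms_permutes: "p \<in> automorphisms G \<Longrightarrow> p permutes verts G"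
  by (simp add: automorphisms_def)

lemma automorphisms_edge_iff:
  assumes "p \<in> automorphisms G" "u \<in> verts G" "v \<in> verts G"
  shows "{p u, p v} \<in> edges G \<longleftrightarrow> {u, v} \<in> edges G"
  using assms by (simp add: automorphisms_def)

lemma id_automorphism: "id \<in> automorphisms G"
  by (simp add: automorphisms_def permutes_id)

lemma comp_automorphism:
  assumes "p \<in> automorphisms G" "q \<in> automorphisms G"
  shows "p \<circ> q \<in> automorphisms G"
  using assms by (auto simp: automorphisms_def permutes_in_image intro: permutes_compose)

lemma inv_automorphism:
  assumes "p \<in> automorphisms G"
  shows "inv p \<in> automorphisms G"
proof -
  have p: "p permutes verts G"
    using assms by (rule automorphisms_permutes)
  have "{inv p u, inv p v} \<in> edges G \<longleftrightarrow> {u, v} \<in> edges G"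
    if "u \<in> verts G" "v \<in> verts G" for u v
    using automorphisms_edge_iff[OF assms, of "inv p u" "inv p v"] that
    by (simp add: permutes_inverses[OF p] permutes_in_image[OF permutes_inv[OF p]])
  then show ?thesis
    using permutes_inv[OF p] by (simp add: automorphisms_def)
qed

lemma orbI: "p \<in> automorphisms G \<Longrightarrow> y = p u \<Longrightarrow> y \<in> orb G u"
  by (auto simp: orb_def)

lemma stab_orbI: "p \<in> stab G x \<Longrightarrow> y = p u \<Longrightarrow> y \<in> stab_orb G x u"
  by (auto simp: stab_orb_def)

lemma orb_image:
  assumes r: "r \<in> automorphisms G"
  shows "orb G (r u) = orb G u"
proof (intro equalityI subsetI)
  fix y assume "y \<in> orb G (r u)"
  then obtain p where "p \<in> automorphisms G" "y = p (r u)"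
    by (auto simp: orb_def)
  then show "y \<in> orb G u"
    using comp_automorphism[OF _ r, of p] by (intro orbI[of "p \<circ> r"]) auto
next
  fix y assume "y \<in> orb G u"
  then obtain p where "p \<in> automorphisms G" "y = p u"
    by (auto simp: orb_def)
  moreover have "(p \<circ> inv r) (r u) = p u"
    using permutes_inverses[OF automorphisms_permutes[OF r]] by simp
  ultimately show "y \<in> orb G (r u)"
    using comp_automorphism[OF _ inv_automorphism[OF r], of p]
    by (intro orbI[of "p \<circ> inv r"]) auto
qed

lemma stab_orb_image:
  assumes r: "r \<in> automorphisms G" and x: "r x = x"
  shows "stab_orb G x (r u) = stab_orb G x u"
proof (intro equalityI subsetI)
  fix y assume "y \<in> stab_orb G x (r u)"
  then obtain p where p: "p \<in> automorphisms G" "p x = x" "y = p (r u)"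
    by (auto simp: stab_orb_def stab_def)
  have "p \<circ> r \<in> stab G x"
    using comp_automorphism[OF p(1) r] p(2) x by (simp add: stab_def)
  then show "y \<in> stab_orb G x u"
    using p(3) by (intro stab_orbI[of "p \<circ> r"]) auto
next
  fix y assume "y \<in> stab_orb G x u"
  then obtain p where p: "p \<in> automorphisms G" "p x = x" "y = p u"
    by (auto simp: stab_orb_def stab_def)
  have inv: "inv r (r z) = z" for z
    using permutes_inverses[OF automorphisms_permutes[OF r]] by simp
  have "p \<circ> inv r \<in> stab G x"
    using comp_automorphism[OF p(1) inv_automorphism[OF r]] p(2) inv[of x] x
    by (simp add: stab_def)
  moreover have "y = (p \<circ> inv r) (r u)"
    using p(3) inv by simp
  ultimately show "y \<in> stab_orb G x (r u)"
    by (rule stab_orbI)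
qed

text \<open>
  A vertex \<open>x\<close> fixed by \<open>r\<close> does not separate \<open>u\<close> from \<open>r u\<close>, since \<open>r\<close> itself belongs to the
  stabilizer of \<open>x\<close>; so the weight demanded by the pair \<open>(u, r u)\<close> sits on vertices moved by \<open>r\<close>.
\<close>

lemma moved_weight_ge_1:
  assumes fin: "finite (verts G)" and g: "fixing_function G g"
    and r: "r \<in> automorphisms G" and u: "u \<in> verts G" "r u \<noteq> u"
  shows "1 \<le> (\<Sum>x\<in>{x \<in> verts G. r x \<noteq> x}. g x)"
proof -
  have "r u \<in> verts G"
    using u permutes_in_image[OF automorphisms_permutes[OF r]] by simp
  then have "(u, r u) \<in> similar_pairs G"
    using u orb_image[OF r, of u] by (auto simp: similar_pairs_def)
  then have "1 \<le> (\<Sum>x\<in>fixing_set G u (r u). g x)"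
    using g by (auto simp: fixing_function_def)
  also have "\<dots> \<le> (\<Sum>x\<in>{x \<in> verts G. r x \<noteq> x}. g x)"
  proof (rule sum_mono2)
    show "fixing_set G u (r u) \<subseteq> {x \<in> verts G. r x \<noteq> x}"
      using stab_orb_image[OF r] by (auto simp: fixing_set_def)
  qed (use fin g in \<open>auto simp: fixing_function_def\<close>)
  finally show ?thesis .
qed

lemma left_in_fixing_set:
  assumes "u \<in> verts G" "u \<noteq> v"
  shows "u \<in> fixing_set G u v"
proof -
  have "u \<in> stab_orb G u u"
    using id_automorphism[of G] by (intro stab_orbI[of id]) (auto simp: stab_def)
  moreover have "u \<notin> stab_orb G u v"
  proof
    assume "u \<in> stab_orb G u v"
    then obtain p where "p \<in> automorphisms G" "p u = u" "p v = u"
      by (auto simp: stab_orb_def stab_def)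
    then show False
      using \<open>u \<noteq> v\<close> permutes_inj[OF automorphisms_permutes] by (metis injD)
  qed
  ultimately show ?thesis
    using assms by (auto simp: fixing_set_def)
qed

lemma fixing_set_commute: "fixing_set G u v = fixing_set G v u"
  by (auto simp: fixing_set_def)

lemma fixing_function_half:
  assumes "finite (verts G)"
  shows "fixing_function G (\<lambda>_. 1/2)"
proof -
  have "1 \<le> (\<Sum>x\<in>fixing_set G u v. 1/2 :: real)" if "(u, v) \<in> similar_pairs G" for u v
  proof -
    have uv: "u \<in> verts G" "v \<in> verts G" "u \<noteq> v"
      using that by (auto simp: similar_pairs_def)
    then have "{u, v} \<subseteq> fixing_set G u v"
      using left_in_fixing_set[of u G v] left_in_fixing_set[of v G u] fixing_set_commute[of G u v]
      by auto
    moreover have "finite (fixing_set G u v)"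
      using assms by (simp add: fixing_set_def)
    ultimately have "(\<Sum>x\<in>{u, v}. 1/2 :: real) \<le> (\<Sum>x\<in>fixing_set G u v. 1/2)"
      by (intro sum_mono2) auto
    then show ?thesis
      using uv by simp
  qed
  then show ?thesis
    by (auto simp: fixing_function_def)
qed

lemma fixing_function_point:
  assumes fin: "finite (verts G)" and a: "a \<in> verts G" "stab G a = {id}"
  shows "fixing_function G (\<lambda>x. if x = a then 1 else 0)"
proof -
  have "a \<in> fixing_set G u v" if "u \<noteq> v" for u v
    using a that by (auto simp: fixing_set_def stab_orb_def)
  moreover have "finite (fixing_set G u v)" for u v
    using fin by (simp add: fixing_set_def)
  ultimately show ?thesis
    by (auto simp: fixing_function_def similar_pairs_def)
qed

lemma frac_fixing_number_eqI:
  assumes "fixing_function G g" "(\<Sum>x\<in>verts G. g x) = r"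
    and "\<And>h. fixing_function G h \<Longrightarrow> r \<le> (\<Sum>x\<in>verts G. h x)"
  shows "frac_fixing_number G = r"
  unfolding frac_fixing_number_def using assms by (intro Least_equality) auto

section \<open>Symmetries of the fan\<close>

lemma verts_fan: "verts (fan_graph n) = insert (Inl ()) (Inr ` {1..n})"
  by (auto simp: fan_graph_def graph_join_def complete_graph_def path_graph_def)

lemma finite_verts_fan: "finite (verts (fan_graph n))"
  by (simp add: verts_fan)

lemma edges_fan:
  "{Inl (), Inr i} \<in> edges (fan_graph n) \<longleftrightarrow> i \<in> {1..n}"
  "{Inr i, Inl ()} \<in> edges (fan_graph n) \<longleftrightarrow> i \<in> {1..n}"
  "{Inl ()} \<notin> edges (fan_graph n)"
  "{Inr i} \<notin> edges (fan_graph n)"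
  "{Inr i, Inr j} \<in> edges (fan_graph n) \<longleftrightarrow>
     i \<in> {1..n} \<and> j \<in> {1..n} \<and> (j = i + 1 \<or> i = j + 1)"
proof -
  have E: "edges (fan_graph n) =
      {{Inr i, Inr (i + 1)} |i. 1 \<le> i \<and> i < n} \<union> {{Inl (), Inr v} |v. v \<in> {1..n}}"
  proof -
    have "{e. e \<subseteq> {()} \<and> card e = 2} = {}"
      by (auto simp: subset_singleton_iff)
    then show ?thesis
      by (auto simp: fan_graph_def graph_join_def complete_graph_def path_graph_def image_iff)
         (metis image_empty image_insert)
  qed
  show "{Inl (), Inr i} \<in> edges (fan_graph n) \<longleftrightarrow> i \<in> {1..n}"
    "{Inr i, Inl ()} \<in> edges (fan_graph n) \<longleftrightarrow> i \<in> {1..n}"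
    "{Inl ()} \<notin> edges (fan_graph n)"
    "{Inr i} \<notin> edges (fan_graph n)"
    "{Inr i, Inr j} \<in> edges (fan_graph n) \<longleftrightarrow>
       i \<in> {1..n} \<and> j \<in> {1..n} \<and> (j = i + 1 \<or> i = j + 1)"
    unfolding E by (auto simp: doubleton_eq_iff)
qed

lemma involution_permutes:
  assumes "\<And>x. p (p x) = x" "\<And>x. x \<notin> S \<Longrightarrow> p x = x"
  shows "p permutes S"
  using assms unfolding permutes_def by metis

definition path_reversal :: "nat \<Rightarrow> unit + nat \<Rightarrow> unit + nat" where
  "path_reversal n = map_sum id (\<lambda>i. if i \<in> {1..n} then n + 1 - i else i)"

lemma path_reversal_automorphism: "path_reversal n \<in> automorphisms (fan_graph n)"
proof -
  have "path_reversal n permutes verts (fan_graph n)"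
  proof (rule involution_permutes)
    show "path_reversal n (path_reversal n x) = x" for x
      by (cases x) (auto simp: path_reversal_def)
    show "x \<notin> verts (fan_graph n) \<Longrightarrow> path_reversal n x = x" for x
      by (cases x) (auto simp: path_reversal_def verts_fan)
  qed
  then show ?thesis
    unfolding automorphisms_def by (auto simp: path_reversal_def verts_fan edges_fan)
qed

lemma hub_middle_swap_automorphism:
  "transpose (Inl ()) (Inr 2) \<in> automorphisms (fan_graph 3)"
proof -
  have "transpose (Inl ()) (Inr 2) permutes verts (fan_graph 3)"
    by (intro permutes_swap_id) (auto simp: verts_fan)
  moreover have "{1..3::nat} = {1, 2, 3}"
    by auto
  ultimately show ?thesis
    unfolding automorphisms_def by (simp add: verts_fan edges_fan transpose_def)
qed

text \<open>
  A path vertex \<open>i\<close> cannot be the image of the hub: for \<open>n \<ge> 4\<close> some path vertex is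
  neither \<open>i\<close> nor adjacent to \<open>i\<close>, whereas the hub is adjacent to every other vertex. This fails
  for \<open>n = 3\<close> and \<open>i = 2\<close>.
\<close>

lemma automorphism_fixes_hub:
  assumes n: "n \<ge> 4" and p: "p \<in> automorphisms (fan_graph n)"
  shows "p (Inl ()) = Inl ()"
proof (rule ccontr)
  assume moved: "p (Inl ()) \<noteq> Inl ()"
  note perm = automorphisms_permutes[OF p]
  have "p (Inl ()) \<in> verts (fan_graph n)"
    using permutes_in_image[OF perm, of "Inl ()"] by (simp add: verts_fan)
  with moved obtain i where i: "p (Inl ()) = Inr i" "i \<in> {1..n}"
    by (auto simp: verts_fan)
  obtain j where j: "j \<in> {1..n}" "j \<noteq> i" "j \<noteq> i + 1" "i \<noteq> j + 1"
  proof (cases "i \<le> 2")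
    case True
    then show ?thesis using n that[of 4] by auto
  next
    case False
    then show ?thesis using n that[of 1] by auto
  qed
  obtain w where w: "p w = Inr j"
    using permutes_surj[OF perm] by (metis surjD)
  have wv: "w \<in> verts (fan_graph n)"
    using permutes_in_image[OF perm, of w] w j by (simp add: verts_fan)
  have "w \<noteq> Inl ()"
    using w i j by auto
  with wv have "{Inl (), w} \<in> edges (fan_graph n)"
    by (auto simp: verts_fan edges_fan)
  then have "{Inr i, Inr j} \<in> edges (fan_graph n)"
    using automorphisms_edge_iff[OF p, of "Inl ()" w] wv w i by (simp add: verts_fan)
  then show False
    using j by (simp add: edges_fan)
qed

text \<open>
  Once the hub and the end \<open>1\<close> are fixed, the vertices are fixed one after the other along the
  path: the image of \<open>k + 1\<close> is a path neighbour of \<open>k\<close>, and \<open>k - 1\<close> is already taken.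
\<close>

lemma stab_path_end:
  assumes n: "n \<ge> 4"
  shows "stab (fan_graph n) (Inr 1) = {id}"
proof (intro equalityI subsetI)
  fix p assume "p \<in> stab (fan_graph n) (Inr 1)"
  then have p: "p \<in> automorphisms (fan_graph n)" and p1: "p (Inr 1) = Inr 1"
    by (auto simp: stab_def)
  note perm = automorphisms_permutes[OF p]
  note inj = permutes_inj[OF perm]
  note hub = automorphism_fixes_hub[OF n p]
  have path: "p (Inr k) = Inr k" if "1 \<le> k" "k \<le> n" for k
    using that
  proof (induction k rule: less_induct)
    case (less k)
    show ?case
    proof (cases "k = 1")
      case True
      then show ?thesis using p1 by simp
    next
      case False
      define m where "m = k - 1"
      have m: "k = m + 1" "1 \<le> m"
        using False less.prems by (auto simp: m_def)
      have pm: "p (Inr m) = Inr m"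
        using less m by simp
      have kv: "Inr k \<in> verts (fan_graph n)" and mv: "Inr m \<in> verts (fan_graph n)"
        using less.prems m by (auto simp: verts_fan)
      have "p (Inr k) \<in> verts (fan_graph n)"
        using kv by (simp add: permutes_in_image[OF perm])
      moreover have "p (Inr k) \<noteq> Inl ()"
        using hub inj by (metis Inl_Inr_False injD)
      ultimately obtain j where j: "p (Inr k) = Inr j"
        by (auto simp: verts_fan)
      have "{Inr m, Inr k} \<in> edges (fan_graph n)"
        using less.prems m by (simp add: edges_fan)
      then have "{Inr m, Inr j} \<in> edges (fan_graph n)"
        using automorphisms_edge_iff[OF p mv kv] pm j by simp
      then have "j = k \<or> (m = j + 1 \<and> 1 \<le> j)"
        using m by (auto simp: edges_fan)
      then show ?thesis
      proof
        assume "j = k"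
        then show ?thesis using j by simp
      next
        assume jm: "m = j + 1 \<and> 1 \<le> j"
        then have "p (Inr j) = Inr j"
          using less m by simp
        then have "k = j"
          using j inj by (metis Inr_inject injD)
        then show ?thesis using jm m by simp
      qed
    qed
  qed
  have "p x = x" for x
  proof (cases "x \<in> verts (fan_graph n)")
    case True
    then show ?thesis using hub path by (auto simp: verts_fan)
  next
    case False
    then show ?thesis using perm by (simp add: permutes_not_in)
  qed
  then show "p \<in> {id}"
    by auto
next
  fix p :: "unit + nat \<Rightarrow> unit + nat" assume "p \<in> {id}"
  then show "p \<in> stab (fan_graph n) (Inr 1)"
    using id_automorphism by (simp add: stab_def)
qed

section \<open>The fractional fixing number of the fan\<close>

lemma frac_fixing_number_fan_3: "frac_fixing_number (fan_graph 3) = 2"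
proof (rule frac_fixing_number_eqI)
  show "fixing_function (fan_graph 3) (\<lambda>_. 1/2)"
    using finite_verts_fan by (rule fixing_function_half)
  show "(\<Sum>x\<in>verts (fan_graph 3). 1/2) = (2::real)"
    by (simp add: card_verts_fan_graph)
next
  fix h assume h: "fixing_function (fan_graph 3) h"
  let ?swap = "transpose (Inl ()) (Inr 2) :: unit + nat \<Rightarrow> unit + nat"
  let ?A = "{x \<in> verts (fan_graph 3). ?swap x \<noteq> x}"
  let ?B = "{x \<in> verts (fan_graph 3). path_reversal 3 x \<noteq> x}"
  have "?swap (Inl ()) \<noteq> Inl ()" "path_reversal 3 (Inr 1) \<noteq> Inr 1"
    by (simp_all add: path_reversal_def)
  then have A: "1 \<le> sum h ?A" and B: "1 \<le> sum h ?B"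
    using moved_weight_ge_1[OF finite_verts_fan h hub_middle_swap_automorphism, of "Inl ()"]
      moved_weight_ge_1[OF finite_verts_fan h path_reversal_automorphism, of "Inr 1"]
    by (simp_all add: verts_fan)
  have "?A \<inter> ?B = {}"
    by (auto simp: path_reversal_def transpose_def split: if_splits)
  then have "sum h ?A + sum h ?B = sum h (?A \<union> ?B)"
    using finite_verts_fan by (intro sum.union_disjoint[symmetric]) auto
  also have "\<dots> \<le> (\<Sum>x\<in>verts (fan_graph 3). h x)"
    using h finite_verts_fan by (intro sum_mono2) (auto simp: fixing_function_def)
  finally show "2 \<le> (\<Sum>x\<in>verts (fan_graph 3). h x)"
    using A B by simp
qed

lemma frac_fixing_number_fan_ge_4:
  assumes n: "n \<ge> 4"
  shows "frac_fixing_number (fan_graph n) = 1"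
proof (rule frac_fixing_number_eqI)
  have "Inr 1 \<in> verts (fan_graph n)"
    using n by (simp add: verts_fan)
  then show "fixing_function (fan_graph n) (\<lambda>x. if x = Inr 1 then 1 else 0)"
    and "(\<Sum>x\<in>verts (fan_graph n). if x = Inr 1 then 1 else 0) = (1::real)"
    using fixing_function_point[OF finite_verts_fan _ stab_path_end[OF n]] finite_verts_fan
    by simp_all
next
  fix h assume h: "fixing_function (fan_graph n) h"
  have "1 \<le> sum h {x \<in> verts (fan_graph n). path_reversal n x \<noteq> x}"
    using moved_weight_ge_1[OF finite_verts_fan h path_reversal_automorphism, of "Inr 1"] n
    by (simp add: verts_fan path_reversal_def)
  also have "\<dots> \<le> (\<Sum>x\<in>verts (fan_graph n). h x)"
    using h finite_verts_fan by (intro sum_mono2) (auto simp: fixing_function_def)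
  finally show "1 \<le> (\<Sum>x\<in>verts (fan_graph n). h x)" .
qed

theorem corollary4p8:
  fixes n :: nat
  assumes "n \<ge> 3"
  shows "frac_fixing_number (fan_graph n) = (if n = 3 then 2 else 1)"
  using assms frac_fixing_number_fan_3 frac_fixing_number_fan_ge_4[of n] by auto

end
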